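(* Let $V_1,\dots,V_p$ be closed subsemimodules of $\mathbb{R}_{\max}^n$, let $V:=V_1\cap\cdots\cap V_p$, and let $u\in\mathbb{R}^n$. Define the cyclic projection sequence by $\xi^0=u$ and $$\xi^{k+1}=P_{V_{(k+1\bmod p)}}(\xi^k)\qquad\forall k\geq0,$$ where $(l\bmod p)$ denotes the unique element of $\{1,\dots,p\}$ congruent to $l$ modulo $p$. Then the sequence $(\xi^k)$ is non-increasing and converges to $P_V(u)$.
   Context: $\mathbb{R}_{\max}=\mathbb{R}\cup\{-\infty\}$ with addition $\oplus=\max$ and multiplication $\otimes=+$, with its usual topology (the one for which $t\mapsto e^t$, with $e^{-\infty}=0$, is a homeomorphism onto $[0,+\infty)$); $\mathbb{R}_{\max}^n$ has the product topology and the entrywise order, and $x\lambda$ denotes the vector with entries $x_i+\lambda$. A subsemimodule of $\mathbb{R}_{\max}^n$ is a subset containing the vector with all entries $-\infty$ and stable under entrywise max and under $x\mapsto x\lambda$ for all $\lambda\in\mathbb{R}_{\max}$. For a closed subsemimodule $W$, $P_W(x):=\max\{w\in W\mid w\leq x\}$. *)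

theory Defs
  imports "HOL-Analysis.Analysis"
begin

(* R_max is the set of extended reals other than \<infinity>. On it, ereal addition and max are the
   tropical operations (with -\<infinity> absorbing for +), and the subspace topology inherited from
   ereal is the one making exp a homeomorphism onto [0, \<infinity>). *)

definition rmax :: "ereal set" where
  "rmax = {a. a \<noteq> \<infinity>}"

definition rmax_vecs :: "(ereal ^ 'n) set" where
  "rmax_vecs = {x. \<forall>i. x $ i \<in> rmax}"

(* ereal ^ 'n carries the product topology, so its subspace topology on rmax_vecs is the product of
   the topologies of the factors R_max. *)

abbreviation rmax_topology :: "(ereal ^ 'n) topology" where
  "rmax_topology \<equiv> top_of_set rmax_vecs"

definition vec_max :: "ereal ^ 'n \<Rightarrow> ereal ^ 'n \<Rightarrow> ereal ^ 'n" where
  "vec_max x y = (\<chi> i. max (x $ i) (y $ i))"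

definition vec_shift :: "ereal ^ 'n \<Rightarrow> ereal \<Rightarrow> ereal ^ 'n" where
  "vec_shift x c = (\<chi> i. x $ i + c)"

definition subsemimodule :: "(ereal ^ 'n) set \<Rightarrow> bool" where
  "subsemimodule W \<longleftrightarrow>
     W \<subseteq> rmax_vecs \<and>
     (\<chi> i. -\<infinity>) \<in> W \<and>
     (\<forall>x\<in>W. \<forall>y\<in>W. vec_max x y \<in> W) \<and>
     (\<forall>x\<in>W. \<forall>c\<in>rmax. vec_shift x c \<in> W)"

(* The order on vectors is the library's entrywise order. Greatest is unspecified when there is no
   greatest element; for a closed subsemimodule W and x in rmax_vecs there always is one. *)

definition max_proj :: "(ereal ^ 'n) set \<Rightarrow> ereal ^ 'n \<Rightarrow> ereal ^ 'n" where
  "max_proj W x = (GREATEST w. w \<in> W \<and> w \<le> x)"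

(* The representative of l modulo p in {1..p}, not in {0..<p}. *)

definition cyc_mod :: "nat \<Rightarrow> nat \<Rightarrow> nat" where
  "cyc_mod l p = (THE j. j \<in> {1..p} \<and> j mod p = l mod p)"

end

theory Submission
  imports Defs
begin

text \<open>Each projection lies below its argument, so the iterates decrease to some vector \<open>l\<close>. Every
  \<open>V i\<close> is closed and is visited infinitely often, hence \<open>l\<close> lies in the intersection. Any element of
  the intersection below \<open>u\<close> stays below all iterates, hence below \<open>l\<close>; so \<open>l\<close> is the projection of \<open>u\<close>.\<close>

text \<open>Folding \<open>vec_max\<close> over finitely many witnesses, one per coordinate, gives a
  single element that dominates each witness in its own coordinate.\<close>

lemma vec_max_closed_bound:
  fixes S :: "(ereal ^ 'n) set"
  assumes "finite A" and "S \<noteq> {}" and "\<And>x y. x \<in> S \<Longrightarrow> y \<in> S \<Longrightarrow> vec_max x y \<in> S"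
    and "\<And>i. f i \<in> S"
  shows "\<exists>w\<in>S. \<forall>i\<in>A. f i $ i \<le> w $ i"
  using assms(1)
proof (induction A)
  case empty
  show ?case using assms(2) by auto
next
  case (insert a A)
  then obtain w where w: "w \<in> S" "\<forall>i\<in>A. f i $ i \<le> w $ i" by blast
  then show ?case
    using assms(3)[OF assms(4)[of a] w(1)]
    by (intro bexI[of _ "vec_max (f a) w"]) (auto simp: vec_max_def max.coboundedI2)
qed

text \<open>\<open>W\<close> is closed only relative to \<open>rmax_vecs\<close>, and a limit in the
  ambient space may have an entry \<infinity>; hence the separate condition on
  \<open>l\<close>.\<close>

lemma closedin_rmax_limit:
  fixes l :: "ereal ^ 'n"
  assumes "closedin rmax_topology W" and "\<And>k. f k \<in> W" and "f \<longlonglongrightarrow> l" and "l \<in> rmax_vecs"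
  shows "l \<in> W"
proof -
  obtain T where T: "closed T" "W = rmax_vecs \<inter> T"
    using assms(1) by (auto simp: closedin_closed)
  have "l \<in> T"
    using closed_sequentially[OF T(1) _ assms(3)] assms(2) T(2) by blast
  then show ?thesis using T(2) assms(4) by blast
qed

lemma rmax_vecs_mono:
  fixes x y :: "ereal ^ 'n"
  assumes "x \<in> rmax_vecs" and "y \<le> x"
  shows "y \<in> rmax_vecs"
  using assms unfolding rmax_vecs_def rmax_def less_eq_vec_def mem_Collect_eq
  by (metis ereal_infty_less_eq(1))

text \<open>The componentwise supremum of the elements below \<open>x\<close> is a limit of finite maxima of such elements.\<close>

lemma ex_greatest_below:
  fixes x :: "ereal ^ 'n"
  assumes W: "subsemimodule W" "closedin rmax_topology W" and x: "x \<in> rmax_vecs"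
  shows "\<exists>s\<in>W. s \<le> x \<and> (\<forall>w\<in>W. w \<le> x \<longrightarrow> w \<le> s)"
proof -
  define S where "S = {w\<in>W. w \<le> x}"
  have ne: "S \<noteq> {}"
    using W(1) by (auto simp: S_def subsemimodule_def less_eq_vec_def)
  have max_in: "vec_max a b \<in> S" if "a \<in> S" "b \<in> S" for a b
    using that W(1) by (auto simp: S_def subsemimodule_def less_eq_vec_def vec_max_def)
  define s :: "ereal ^ 'n" where "s = (\<chi> i. SUP w\<in>S. w $ i)"
  have upper: "w \<le> s" if "w \<in> S" for w
    using that by (auto simp: s_def less_eq_vec_def intro: SUP_upper)
  have "s \<le> x"
    by (auto simp: s_def S_def less_eq_vec_def intro: SUP_least)
  \<comment> \<open>Different coordinates of \<open>s\<close> may be approached by different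
    elements of \<open>S\<close>, so each coordinate first gets its own sequence.\<close>
  have "\<exists>g. \<forall>k. g k \<in> S \<and> (\<lambda>k. g k $ i) \<longlonglongrightarrow> s $ i" for i
  proof -
    obtain h where h: "incseq h" "range h \<subseteq> (\<lambda>w. w $ i) ` S"
        "(SUP w\<in>S. w $ i) = (SUP k::nat. h k)"
      using Sup_countable_SUP[of "(\<lambda>w. w $ i) ` S"] ne by auto
    have "\<forall>k. \<exists>w\<in>S. h k = w $ i" using h(2) by blast
    then obtain g where g: "\<forall>k. g k \<in> S \<and> h k = g k $ i" by metis
    have "h \<longlonglongrightarrow> s $ i"
      using LIMSEQ_SUP[OF h(1)] h(3) by (simp add: s_def)
    moreover have "h = (\<lambda>k. g k $ i)" using g by auto
    ultimately show ?thesis using g by auto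
  qed
  then obtain g where g: "\<And>i k. g i k \<in> S" "\<And>i. (\<lambda>k. g i k $ i) \<longlonglongrightarrow> s $ i"
    by metis
  have "\<forall>k. \<exists>w\<in>S. \<forall>i. g i k $ i \<le> w $ i"
    using vec_max_closed_bound[OF finite[of UNIV] ne max_in g(1)] by auto
  then obtain w where w: "\<And>k. w k \<in> S" "\<And>k i. g i k $ i \<le> w k $ i"
    by metis
  \<comment> \<open>Squeeze: \<open>w k $ i\<close> lies between \<open>g i k $ i\<close> and
    \<open>s $ i\<close>, so a single sequence in \<open>S\<close> converges to \<open>s\<close> in
    all coordinates.\<close>
  have "(\<lambda>k. w k $ i) \<longlonglongrightarrow> s $ i" for i
    using upper[OF w(1)] w(2)
    by (intro tendsto_sandwich[OF _ _ g(2) tendsto_const]) (auto simp: less_eq_vec_def)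
  then have "w \<longlonglongrightarrow> s" by (rule vec_tendstoI)
  then have "s \<in> W"
    using closedin_rmax_limit[OF W(2), of w s] w(1) rmax_vecs_mono[OF x \<open>s \<le> x\<close>]
    by (auto simp: S_def)
  then show ?thesis using \<open>s \<le> x\<close> upper by (auto simp: S_def)
qed

lemma max_proj_eqI:
  assumes "s \<in> W" and "s \<le> x" and "\<And>w. w \<in> W \<Longrightarrow> w \<le> x \<Longrightarrow> w \<le> s"
  shows "max_proj W x = s"
  unfolding max_proj_def using assms by (intro Greatest_equality) auto

lemma
  fixes x :: "ereal ^ 'n"
  assumes "subsemimodule W" and "closedin rmax_topology W" and "x \<in> rmax_vecs"
  shows max_proj_in: "max_proj W x \<in> W"
    and max_proj_le: "max_proj W x \<le> x"
    and max_proj_greatest: "w \<in> W \<Longrightarrow> w \<le> x \<Longrightarrow> w \<le> max_proj W x"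
  using ex_greatest_below[OF assms] max_proj_eqI by metis+

lemma cyc_mod_eqI:
  assumes "j \<in> {1..p}" and "l mod p = j mod p"
  shows "cyc_mod l p = j"
  unfolding cyc_mod_def
proof (rule the_equality)
  show "j \<in> {1..p} \<and> j mod p = l mod p" using assms by simp
  fix j' assume "j' \<in> {1..p} \<and> j' mod p = l mod p"
  \<comment> \<open>Within \<open>{1..p}\<close> only \<open>p\<close> has residue 0; every other
    element is its own residue.\<close>
  then show "j' = j"
    using assms by (cases "j = p"; cases "j' = p") auto
qed

lemma cyc_mod_range:
  assumes "p \<ge> 1"
  shows "cyc_mod l p \<in> {1..p}"
proof -
  define j where "j = (if l mod p = 0 then p else l mod p)"
  have "j \<in> {1..p}" "l mod p = j mod p"
    using assms by (auto simp: j_def intro: less_imp_le)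
  then show ?thesis using cyc_mod_eqI by metis
qed

theorem theorem8p1:
  fixes p :: nat
    and V :: "nat \<Rightarrow> (ereal ^ 'n) set"
    and u :: "real ^ 'n"
    and \<xi> :: "nat \<Rightarrow> ereal ^ 'n"
  assumes "p \<ge> 1"
    and "\<And>i. i \<in> {1..p} \<Longrightarrow> subsemimodule (V i)"
    and "\<And>i. i \<in> {1..p} \<Longrightarrow> closedin rmax_topology (V i)"
    and "\<xi> 0 = (\<chi> i. ereal (u $ i))"
    and "\<And>k. \<xi> (Suc k) = max_proj (V (cyc_mod (k + 1) p)) (\<xi> k)"
  shows "decseq \<xi> \<and>
    limitin rmax_topology \<xi> (max_proj (\<Inter>i\<in>{1..p}. V i) (\<chi> i. ereal (u $ i))) sequentially"
proof -
  note range = cyc_mod_range[OF assms(1)]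
  note V = assms(2)[OF range] assms(3)[OF range]
  have rmax: "\<xi> k \<in> rmax_vecs" for k
  proof (induction k)
    case 0
    show ?case by (simp add: assms(4) rmax_vecs_def rmax_def)
  next
    case (Suc k)
    then show ?case using rmax_vecs_mono max_proj_le[OF V] assms(5) by metis
  qed
  have dec: "decseq \<xi>"
    using max_proj_le[OF V rmax] by (simp add: decseq_Suc_iff assms(5))
  \<comment> \<open>Entries of the limit may drop to -\<infinity>, which \<open>ereal\<close> infima
    cover without any boundedness argument.\<close>
  define l :: "ereal ^ 'n" where "l = (\<chi> i. INF k. \<xi> k $ i)"
  have "(\<lambda>k. \<xi> k $ i) \<longlonglongrightarrow> l $ i" for i
    unfolding l_def vec_lambda_beta
    using decseqD[OF dec] by (intro LIMSEQ_INF antimonoI) (simp add: less_eq_vec_def)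
  then have lim: "\<xi> \<longlonglongrightarrow> l" by (rule vec_tendstoI)
  have l_le: "l \<le> \<xi> k" for k
    by (auto simp: l_def less_eq_vec_def intro: INF_lower)
  have l_rmax: "l \<in> rmax_vecs" by (rule rmax_vecs_mono[OF rmax l_le])
  have "l \<in> V i" if i: "i \<in> {1..p}" for i
  proof (rule closedin_rmax_limit[OF assms(3)[OF i] _ _ l_rmax])
    \<comment> \<open>The index equals \<open>m * p + i\<close>, as \<open>i \<ge> 1\<close>; the
      form with \<open>Suc\<close> exposes the projection onto \<open>V i\<close> that produced this
      iterate.\<close>
    show "\<xi> (Suc (m * p + (i - 1))) \<in> V i" for m
    proof -
      have "cyc_mod (m * p + (i - 1) + 1) p = i"
        using i by (intro cyc_mod_eqI) auto
      then show ?thesis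
        using max_proj_in[OF V rmax] assms(5) by metis
    qed
    have "strict_mono (\<lambda>m. Suc (m * p + (i - 1)))"
      using assms(1) by (auto simp: strict_mono_def)
    from LIMSEQ_subseq_LIMSEQ[OF lim this]
    show "(\<lambda>m. \<xi> (Suc (m * p + (i - 1)))) \<longlonglongrightarrow> l" by (simp add: o_def)
  qed
  moreover have "w \<le> l" if w: "w \<in> (\<Inter>i\<in>{1..p}. V i)" "w \<le> \<xi> 0" for w
  proof -
    have "w \<le> \<xi> k" for k
    proof (induction k)
      case (Suc k)
      \<comment> \<open>As \<open>w\<close> lies in the set projected onto and below
        \<open>\<xi> k\<close>, the greatest such element cannot fall below
        \<open>w\<close>.\<close>
      have "w \<in> V (cyc_mod (k + 1) p)" using w(1) range by blast
      then show ?case using max_proj_greatest[OF V rmax _ Suc] by (simp add: assms(5))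
    qed (rule w(2))
    then show ?thesis by (auto simp: l_def less_eq_vec_def intro: INF_greatest)
  qed
  ultimately have "max_proj (\<Inter>i\<in>{1..p}. V i) (\<xi> 0) = l"
    using l_le by (intro max_proj_eqI) auto
  \<comment> \<open>Convergence in the subspace is ambient convergence together with membership of
    the limit and the iterates in \<open>rmax_vecs\<close>.\<close>
  then show ?thesis
    using dec lim l_rmax rmax by (simp add: limitin_subtopology assms(4))
qed

end
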